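(* Let $G$ be a connected, locally finite (possibly infinite) $L_1$-graph on at least three vertices such that $|N(u)\cap N(v)|\ge 2$ for each pair of vertices $u,v$ with $d(u,v)=2$, and let $x$ and $y$ be two adjacent vertices of $G$ with no common neighbors. Then for every $x$–$y$ path $P_n$ with $n$ vertices in $G$ that does not contain all vertices of $G$, there is an $x$–$y$ path $P_{n+\ell}$ with $n+\ell$ vertices, $1\le\ell\le 2$, such that $V(P_n)\subset V(P_{n+\ell})$, unless $n=|V(G)|-1$ and $G\in\mathcal{K}$.
   Context: All graphs are simple. $N(u)$ denotes the neighborhood of $u$, $d(u)=|N(u)|$, and $d(u,v)$ the distance. A graph is locally finite if every vertex has finite degree. A graph $G$ is an $L_1$-graph if $d(u)+d(v)\ge |N(u)\cup N(v)\cup N(w)|-1$ for every triple of vertices $u,v,w$ with $d(u,v)=2$ and $w\in N(u)\cap N(v)$. $\mathcal{K}=\{G : K_{p,p+1}\subseteq G\subseteq K_p\vee\overline{K_{p+1}}\text{ for some }p\ge 2\}$, where $\vee$ denotes the join and $\overline{K_{p+1}}$ the edgeless graph on $p+1$ vertices. *)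

theory Defs
  imports "Graph_Theory.Graph_Theory"
begin

text \<open>
  A simple, possibly infinite, undirected graph is a symmetric loop-free digraph without
  parallel arcs, i.e. a \<^typ>\<open>'a pair_pre_digraph\<close> satisfying
  \<^const>\<open>pair_bidirected_digraph\<close>; the edge \<open>uv\<close> is the pair of arcs \<open>(u,v)\<close>, \<open>(v,u)\<close>.
\<close>

definition neighborhood :: "'a pair_pre_digraph \<Rightarrow> 'a \<Rightarrow> 'a set" where
  "neighborhood G u = {v \<in> pverts G. (u, v) \<in> parcs G}"

definition degree :: "'a pair_pre_digraph \<Rightarrow> 'a \<Rightarrow> nat" where
  "degree G u = card (neighborhood G u)"

definition locally_finite :: "'a pair_pre_digraph \<Rightarrow> bool" where
  "locally_finite G \<longleftrightarrow> (\<forall>u \<in> pverts G. finite (neighborhood G u))"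

text \<open>With all arcs of cost 1, the cost of a walk is its number of edges.\<close>

definition distance :: "'a pair_pre_digraph \<Rightarrow> 'a \<Rightarrow> 'a \<Rightarrow> ereal" where
  "distance G u v = wf_digraph.\<mu> (with_proj G) (\<lambda>_. 1) u v"

text \<open>Stated over the integers, so that the subtraction is not truncated.\<close>

definition L1_graph :: "'a pair_pre_digraph \<Rightarrow> bool" where
  "L1_graph G \<longleftrightarrow>
    (\<forall>u \<in> pverts G. \<forall>v \<in> pverts G. \<forall>w. distance G u v = 2 \<longrightarrow>
      w \<in> neighborhood G u \<inter> neighborhood G v \<longrightarrow>
      int (degree G u) + int (degree G v)
        \<ge> int (card (neighborhood G u \<union> neighborhood G v \<union> neighborhood G w)) - 1)"

definition edgeless_graph :: "nat \<Rightarrow> 'a pair_pre_digraph \<Rightarrow> bool" where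
  "edgeless_graph n H \<longleftrightarrow> finite (pverts H) \<and> card (pverts H) = n \<and> parcs H = {}"

text \<open>Meaningful only for graphs with disjoint vertex sets.\<close>

definition graph_join :: "'a pair_pre_digraph \<Rightarrow> 'a pair_pre_digraph \<Rightarrow> 'a pair_pre_digraph" where
  "graph_join H I = \<lparr> pverts = pverts H \<union> pverts I,
     parcs = parcs H \<union> parcs I \<union> pverts H \<times> pverts I \<union> pverts I \<times> pverts H \<rparr>"

text \<open>
  The graphs \<open>B\<close>, \<open>C\<close> and \<open>D\<close> are arbitrary labelled copies of $K_{p,p+1}$, $K_p$ and
  $\overline{K_{p+1}}$, so the class is closed under isomorphism. No copies are lost by taking
  them over the vertex type of \<open>G\<close>: the two inclusions force all vertex sets to lie in that of \<open>G\<close>.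
\<close>

definition class_K :: "'a pair_pre_digraph \<Rightarrow> bool" where
  "class_K G \<longleftrightarrow>
    (\<exists>p \<ge> 2. \<exists>(B :: 'a pair_pre_digraph) (C :: 'a pair_pre_digraph) (D :: 'a pair_pre_digraph).
      complete_bipartite_digraph p (p + 1) (with_proj B) \<and>
      complete_digraph p (with_proj C) \<and> edgeless_graph (p + 1) D \<and>
      pverts C \<inter> pverts D = {} \<and>
      subgraph (with_proj B) (with_proj G) \<and>
      subgraph (with_proj G) (with_proj (graph_join C D)))"

definition path_between :: "'a pair_pre_digraph \<Rightarrow> 'a \<Rightarrow> 'a list \<Rightarrow> 'a \<Rightarrow> bool" where
  "path_between G x P y \<longleftrightarrow> vpath P (with_proj G) \<and> hd P = x \<and> last P = y"

end

theory Submission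
  imports Defs
begin

text \<open>
  Let \<open>P\<close> be an \<open>x\<close>--\<open>y\<close> path without an extension by one or two vertices, and \<open>w\<close> a vertex off \<open>P\<close>
  with neighbours \<open>w\<^sub>1, \<dots>, w\<^sub>k\<close> on \<open>P\<close>; reversing \<open>P\<close> if necessary, \<open>w\<close> is not adjacent to \<open>y\<close>. The
  successors \<open>w\<^sub>i\<^sup>+\<close> together with \<open>w\<close> form an independent set, and the common neighbours of \<open>w\<close>
  and \<open>w\<^sub>i\<^sup>+\<close> lie among the \<open>w\<^sub>j\<close>. The \<open>L\<^sub>1\<close> condition for \<open>w\<close>, \<open>w\<^sub>i\<^sup>+\<close> and the middle vertex \<open>w\<^sub>i\<close> says
  that \<open>w\<^sub>i\<^sup>+\<close> has at least as many neighbours among the \<open>w\<^sub>j\<close> as \<open>w\<^sub>i\<close> has among the \<open>w\<^sub>j\<^sup>+\<close>. Double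
  counting turns all these inequalities into equalities, whence every neighbour of \<open>w\<^sub>i\<close> is adjacent
  to \<open>w\<close> or \<open>w\<^sub>i\<^sup>+\<close>, or is \<open>w\<close> or some \<open>w\<^sub>j\<^sup>+\<close>. Applied to the predecessor of \<open>w\<^sub>i\<close> (and to \<open>y\<close> if
  \<open>w\<^sub>i = x\<close>) this forces \<open>P\<close> to alternate between neighbours of \<open>w\<close> and their successors, starting
  with a neighbour. The \<open>L\<^sub>1\<close> condition for two consecutive successors then shows that no other vertex
  off \<open>P\<close> is adjacent to \<open>P\<close> and that all successors have the same neighbourhood, so \<open>G\<close> belongs
  to the class \<open>\<K>\<close>.
\<close>

section \<open>Decomposing a list at one or two pairs of consecutive entries\<close>

lemma split_at_one:
  assumes "Suc i < length P"
  obtains A B where "P = A @ P ! i # P ! Suc i # B" "length A = i"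
proof
  show "P = take i P @ P ! i # P ! Suc i # drop (Suc (Suc i)) P"
    using assms by (metis Cons_nth_drop_Suc Suc_lessD append_take_drop_id)
qed (use assms in simp)

lemma split_at_two:
  assumes "Suc i < j" "Suc j < length P"
  obtains A M B where "P = A @ P ! i # P ! Suc i # M @ P ! j # P ! Suc j # B" "length A = i"
proof -
  obtain A B where P: "P = A @ P ! i # P ! Suc i # B" "length A = i"
    using split_at_one[of i P] assms by auto
  define k where "k = j - Suc (Suc i)"
  have j: "j = Suc (Suc i) + k" using assms by (simp add: k_def)
  have "P ! j = B ! k" "P ! Suc j = B ! Suc k"
    by (subst P(1); simp add: P(2) j nth_append)+
  moreover have "length P = Suc (Suc i) + length B" by (subst P(1)) (simp add: P(2))
  then obtain M C where "B = M @ B ! k # B ! Suc k # C"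
    using split_at_one[of k B] assms j by (metis add_less_cancel_left add_Suc_right)
  ultimately show ?thesis using that[of A M C] P by metis
qed

section \<open>Adjacency relations with the local form of the degree condition\<close>

definition nbhd :: "('a \<Rightarrow> 'a \<Rightarrow> bool) \<Rightarrow> 'a \<Rightarrow> 'a set" where
  "nbhd E u = {v. E u v}"

text \<open>
  The assumption \<open>local_ore\<close> is the \<open>L\<^sub>1\<close> condition after cancelling \<open>|N(u) \<union> N(v)|\<close> by
  inclusion--exclusion.
\<close>

locale local_ore_graph =
  fixes E :: "'a \<Rightarrow> 'a \<Rightarrow> bool"
  assumes sym: "E u v \<Longrightarrow> E v u"
    and irrefl: "\<not> E u u"
    and finite_N: "finite (nbhd E u)"
    and two_common: "u \<noteq> v \<Longrightarrow> \<not> E u v \<Longrightarrow> E w u \<Longrightarrow> E w v \<Longrightarrow> 2 \<le> card (nbhd E u \<inter> nbhd E v)"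
    and local_ore: "u \<noteq> v \<Longrightarrow> \<not> E u v \<Longrightarrow> E w u \<Longrightarrow> E w v \<Longrightarrow>
      card (nbhd E w - (nbhd E u \<union> nbhd E v)) \<le> card (nbhd E u \<inter> nbhd E v) + 1"
begin

abbreviation N :: "'a \<Rightarrow> 'a set" where
  "N \<equiv> nbhd E"

lemma in_N [simp]: "v \<in> N u \<longleftrightarrow> E u v"
  by (simp add: nbhd_def)

lemma E_commute: "E u v \<longleftrightarrow> E v u"
  using sym by blast

definition path :: "'a \<Rightarrow> 'a list \<Rightarrow> 'a \<Rightarrow> bool" where
  "path x P y \<longleftrightarrow> successively E P \<and> distinct P \<and> P \<noteq> [] \<and> hd P = x \<and> last P = y"

definition unextendable :: "'a \<Rightarrow> 'a list \<Rightarrow> 'a \<Rightarrow> bool" where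
  "unextendable x P y \<longleftrightarrow> path x P y \<and>
    (\<forall>Q. path x Q y \<longrightarrow> set P \<subset> set Q \<longrightarrow>
      length Q \<noteq> length P + 1 \<and> length Q \<noteq> length P + 2)"

lemma path_rev: "path x P y \<Longrightarrow> path y (rev P) x"
  unfolding path_def by (simp add: hd_rev last_rev successively_rev E_commute[symmetric])

lemma unextendable_rev: "unextendable x P y \<Longrightarrow> unextendable y (rev P) x"
  unfolding unextendable_def using path_rev by (metis length_rev rev_rev_ident set_rev)

lemma successively_rev_iff [simp]: "successively E (rev xs) \<longleftrightarrow> successively E xs"
  by (simp add: successively_rev E_commute[symmetric])

end

section \<open>Reroutings that an unextendable path rules out\<close>

locale unextendable_path = local_ore_graph +
  fixes x y :: 'a and P :: "'a list"
  assumes unext: "unextendable x P y"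
    and xy: "E x y" "nbhd E x \<inter> nbhd E y = {}"
begin

lemma P_path: "path x P y" using unext by (simp add: unextendable_def)

lemma P_props: "successively E P" "distinct P" "P \<noteq> []" "hd P = x" "last P = y"
  using P_path by (auto simp: path_def)

lemma no_extension:
  assumes "successively E Q" "distinct Q" "Q \<noteq> []" "hd Q = x" "last Q = y"
    and "set P \<subset> set Q" "length Q = length P + 1 \<or> length Q = length P + 2"
  shows False
  using assms unext unfolding unextendable_def path_def by blast

lemma edge: "Suc i < length P \<Longrightarrow> E (P ! i) (P ! Suc i)"
  using P_props(1) by (simp add: successively_conv_nth)

lemma nth_eq: "i < length P \<Longrightarrow> j < length P \<Longrightarrow> P ! i = P ! j \<longleftrightarrow> i = j"
  using P_props(2) by (simp add: nth_eq_iff_index_eq)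

lemma move_insert:
  assumes "w \<notin> set P" "E w (P ! i)" "Suc i < length P"
  shows "\<not> E w (P ! Suc i)"
proof
  assume w: "E w (P ! Suc i)"
  obtain u v where uv: "u = P ! i" "v = P ! Suc i" by simp
  obtain A B where P: "P = A @ u # v # B" using split_at_one assms(3) uv by metis
  have "E w u" "E w v" using assms w uv by auto
  then show False
    using P_props assms(1)
    by (intro no_extension[of "A @ u # w # v # B"])
      (auto simp: P E_commute successively_append_iff successively_Cons hd_append)
qed

text \<open>Otherwise \<open>w\<close> and \<open>z\<close> together could be inserted between the
  two consecutive vertices, an extension by two.\<close>

lemma move_insert_two:
  assumes "w \<notin> set P" "E w (P ! i)" "Suc i < length P" "E w z" "E z (P ! Suc i)"
  shows "z \<in> set P"
proof (rule ccontr)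
  assume z: "z \<notin> set P"
  obtain u v where uv: "u = P ! i" "v = P ! Suc i" by simp
  obtain A B where P: "P = A @ u # v # B" using split_at_one assms(3) uv by metis
  have "z \<noteq> w" using assms(4) irrefl by auto
  moreover have "E w u" "E w z" "E z v" using assms uv by auto
  ultimately show False
    using P_props assms(1) z
    by (intro no_extension[of "A @ u # w # z # v # B"])
      (auto simp: P E_commute successively_append_iff successively_Cons hd_append)
qed

text \<open>Otherwise follow \<open>P\<close> to \<open>P ! i\<close>, pass through \<open>w\<close>
  to \<open>P ! j\<close>, go back along \<open>P\<close> to \<open>P ! Suc i\<close> and take the
  chord to \<open>P ! Suc j\<close>; this adds exactly \<open>w\<close>.\<close>

lemma move_cross:
  assumes "w \<notin> set P" "E w (P ! i)" "E w (P ! j)" "i < j" "Suc j < length P"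
  shows "\<not> E (P ! Suc i) (P ! Suc j)"
proof
  assume e: "E (P ! Suc i) (P ! Suc j)"
  obtain u v s t where uv: "u = P ! i" "v = P ! Suc i" "s = P ! j" "t = P ! Suc j" by simp
  have "Suc i < j" using move_insert[of w i] assms by (cases "Suc i = j") auto
  then obtain A M B where P: "P = A @ u # v # M @ s # t # B"
    using split_at_two[of i j P] assms(5) unfolding uv by metis
  have "E w u" "E w s" "E v t" using assms e uv by auto
  then show False
    using P_props assms(1)
    by (intro no_extension[of "A @ u # w # s # rev M @ v # t # B"])
      (auto simp: P E_commute successively_append_iff successively_Cons hd_append hd_rev last_rev
        split: if_splits)
qed

text \<open>The vertex at position \<open>i\<close> is bypassed and reinserted, together with \<open>w\<close>, right after
  position \<open>j\<close>.\<close>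

lemma move_relocate:
  assumes "w \<notin> set P" "E w (P ! i)" "E w (P ! j)" "i \<noteq> j" "Suc i < length P" "Suc j < length P"
    and "0 < i" "E (P ! (i - 1)) (P ! Suc i)"
  shows "\<not> E (P ! i) (P ! Suc j)"
proof
  assume e: "E (P ! i) (P ! Suc j)"
  have n1: "Suc i \<noteq> j" using move_insert[of w i] assms by auto
  have n2: "Suc j \<noteq> i" using move_insert[of w j] assms by auto
  obtain u v s t where uv: "u = P ! i" "v = P ! Suc i" "s = P ! j" "t = P ! Suc j" by simp
  obtain r where r: "r = P ! (i - 1)" by simp
  have E: "E w u" "E w s" "E u t" "E r v" using assms e uv r by auto
  show False
  proof (cases "i < j")
    case True
    then have "Suc i < j" using n1 by simp
    then obtain A M B where P: "P = A @ u # v # M @ s # t # B" and A: "length A = i"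
      using split_at_two[of i j P] assms(6) unfolding uv by metis
    have "A \<noteq> []" "r = last A"
      using A assms(7) unfolding r by (auto simp: P nth_append last_conv_nth)
    then show False using P_props assms(1) E
      by (intro no_extension[of "A @ v # M @ s # w # u # t # B"])
        (auto simp: P E_commute successively_append_iff successively_Cons hd_append split: if_splits)
  next
    case False
    then have "Suc j < i" using n2 assms(4) by simp
    then obtain A M B where P: "P = A @ s # t # M @ u # v # B"
      using split_at_two[of j i P] assms(5) unfolding uv by metis
    define k where "k = length A + 1 + length M"
    have "P ! Suc k = u" "Suc k < length P" by (simp_all add: P k_def nth_append)
    then have "i = Suc k" using nth_eq assms(5) uv by auto
    then have "r = last (t # M)"
      unfolding r by (auto simp: P k_def nth_append last_conv_nth nth_Cons')
    then show False using P_props assms(1) E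
      by (intro no_extension[of "A @ s # w # u # t # M @ v # B"])
        (auto simp: P E_commute successively_append_iff successively_Cons hd_append split: if_splits)
  qed
qed

text \<open>Otherwise the segment from position 1 to position 2 can be reversed, with
  \<open>w\<close> inserted before it and \<open>q\<close> after it.\<close>

lemma move_two_types:
  assumes "4 \<le> length P" "w \<notin> set P" "q \<notin> set P" "w \<noteq> q"
    and "E w (P ! 0)" "E w (P ! 2)" "E q (P ! 1)"
  shows "\<not> E q (P ! 3)"
proof
  assume e: "E q (P ! 3)"
  obtain a b c d B where P: "P = a # b # c # d # B"
    using assms(1) by (auto simp: Suc_le_length_iff numeral_eq_Suc)
  have "E w a" "E w c" "E q b" "E q d" using assms e by (auto simp: P)
  then show False
    using P_props assms(2-4)
    by (intro no_extension[of "a # w # c # b # q # d # B"])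
      (auto simp: P E_commute successively_Cons split: if_splits)
qed

end

section \<open>Double counting around a vertex off the path\<close>

locale attached_vertex = unextendable_path +
  fixes w :: 'a
  assumes w_off: "w \<notin> set P" and w_y: "\<not> E w y" and w_attached: "nbhd E w \<inter> set P \<noteq> {}"
begin

definition I :: "nat set" where
  "I = {i. i < length P \<and> E w (P ! i)}"

abbreviation S :: "nat \<Rightarrow> 'a" where
  "S i \<equiv> P ! Suc i"

lemma finite_I: "finite I"
  by (simp add: I_def)

text \<open>The last vertex of \<open>P\<close> is \<open>y\<close>, which \<open>w\<close> avoids;
  hence \<open>S i\<close> is a genuine path vertex for \<open>i\<close> in
  \<open>I\<close>.\<close>

lemma I_Suc: "i \<in> I \<Longrightarrow> Suc i < length P"
  using w_y P_props(3,5) unfolding I_def last_conv_nth[OF P_props(3)]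
  by (metis (no_types, lifting) Suc_lessI diff_Suc_1 mem_Collect_eq)

lemma I_E: "i \<in> I \<Longrightarrow> E w (P ! i)"
  by (simp add: I_def)

lemma not_E_w_S: "i \<in> I \<Longrightarrow> \<not> E w (S i)"
  using move_insert[OF w_off] I_E I_Suc by blast

lemma S_indep: "i \<in> I \<Longrightarrow> j \<in> I \<Longrightarrow> \<not> E (S i) (S j)"
  using move_cross[OF w_off] I_E I_Suc irrefl E_commute by (metis linorder_neqE_nat)

lemma S_neq_w: "i \<in> I \<Longrightarrow> S i \<noteq> w"
  using w_off I_Suc nth_mem by metis

lemma inj_P: "inj_on ((!) P) I"
  by (auto simp: inj_on_def I_def nth_eq)

lemma inj_S: "inj_on S I"
  using I_Suc nth_eq by (auto simp: inj_on_def)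

lemma common_S_subset: "i \<in> I \<Longrightarrow> N w \<inter> N (S i) \<subseteq> (!) P ` {j \<in> I. E (P ! j) (S i)}"
proof
  fix z assume i: "i \<in> I" and z: "z \<in> N w \<inter> N (S i)"
  then have "z \<in> set P"
    using move_insert_two[OF w_off I_E I_Suc] E_commute by auto
  then show "z \<in> (!) P ` {j \<in> I. E (P ! j) (S i)}"
    using z by (auto simp: in_set_conv_nth I_def E_commute)
qed

lemma card_common_S: "i \<in> I \<Longrightarrow> card (N w \<inter> N (S i)) = card {j \<in> I. E (P ! j) (S i)}"
proof -
  assume i: "i \<in> I"
  have "N w \<inter> N (S i) = (!) P ` {j \<in> I. E (P ! j) (S i)}"
    using common_S_subset[OF i] E_commute by (auto simp: I_def)
  then show ?thesis
    by (simp add: card_image inj_on_subset[OF inj_P])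
qed

lemma two_le_card_common_S: "i \<in> I \<Longrightarrow> 2 \<le> card (N w \<inter> N (S i))"
  using two_common[of w "S i" "P ! i"] not_E_w_S S_neq_w I_E I_Suc edge E_commute by metis

text \<open>By independence of the successors, these vertices all count towards the left-hand side
  of \<open>local_ore\<close> for \<open>w\<close>, \<open>S i\<close> and the middle vertex
  \<open>P ! i\<close>.\<close>

lemma private_subset:
  "i \<in> I \<Longrightarrow> insert w (S ` {j \<in> I. E (P ! i) (S j)}) \<subseteq> N (P ! i) - (N w \<union> N (S i))"
  using not_E_w_S S_indep I_E E_commute irrefl by auto

lemma card_private: "i \<in> I \<Longrightarrow>
  card (insert w (S ` {j \<in> I. E (P ! i) (S j)})) = card {j \<in> I. E (P ! i) (S j)} + 1"
proof -
  assume i: "i \<in> I"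
  have "w \<notin> S ` {j \<in> I. E (P ! i) (S j)}" using S_neq_w by auto
  then show ?thesis
    using finite_I by (simp add: card_image inj_on_subset[OF inj_S])
qed

lemma local_ore_S:
  "i \<in> I \<Longrightarrow> card (N (P ! i) - (N w \<union> N (S i))) \<le> card (N w \<inter> N (S i)) + 1"
  using local_ore[of w "S i" "P ! i"] not_E_w_S S_neq_w I_E I_Suc edge E_commute by metis

lemma finite_private: "finite (N (P ! i) - (N w \<union> N (S i)))"
  using finite_N by blast

text \<open>Summed over all \<open>i \<in> I\<close>, the two sides count the edges between \<open>P ! i\<close> and \<open>S j\<close>
  in two ways, so the local inequalities are all equalities.\<close>

lemma card_common_S_eq:
  assumes "i \<in> I"
  shows "card {j \<in> I. E (P ! i) (S j)} = card (N w \<inter> N (S i))"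
proof (rule sum_mono_inv[OF _ _ assms finite_I])
  show "card {j \<in> I. E (P ! i) (S j)} \<le> card (N w \<inter> N (S i))" if "i \<in> I" for i
    using card_mono[OF finite_private private_subset[OF that]] card_private[OF that]
      local_ore_S[OF that] by simp
  show "(\<Sum>i\<in>I. card {j \<in> I. E (P ! i) (S j)}) = (\<Sum>i\<in>I. card (N w \<inter> N (S i)))"
    by (rule sum_multicount_gen) (simp_all add: finite_I card_common_S)
qed

text \<open>Equality in the double counting leaves no room for further private neighbours, so the
  inclusion in \<open>private_subset\<close> is an equality.\<close>

lemma N_subset:
  assumes "i \<in> I"
  shows "N (P ! i) \<subseteq> N w \<union> N (S i) \<union> insert w (S ` I)"
proof -
  have "insert w (S ` {j \<in> I. E (P ! i) (S j)}) = N (P ! i) - (N w \<union> N (S i))"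
    by (rule card_seteq[OF finite_private private_subset[OF assms]])
      (use card_private[OF assms] local_ore_S[OF assms] card_common_S_eq[OF assms] in simp)
  then show ?thesis by auto
qed

section \<open>The path alternates between neighbours of \<open>w\<close> and their
  successors\<close>

lemma exists_other_S:
  assumes "i \<in> I"
  shows "\<exists>j\<in>I. j \<noteq> i \<and> E (P ! i) (S j)"
proof (rule ccontr)
  assume "\<not> ?thesis"
  then have "{j \<in> I. E (P ! i) (S j)} \<subseteq> {i}" by auto
  then have "card {j \<in> I. E (P ! i) (S j)} \<le> card {i}" by (intro card_mono) auto
  then show False
    using card_common_S_eq[OF assms] two_le_card_common_S[OF assms] by simp
qed

text \<open>The predecessor of \<open>P ! Suc i\<close> must fall under one of the cases of
  \<open>N_subset\<close>. It is not \<open>w\<close>, and not adjacent to \<open>w\<close> by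
  \<open>move_insert\<close>. If it were adjacent to \<open>S (Suc i)\<close>, then
  \<open>P ! Suc i\<close> could be bypassed and moved in front of another successor adjacent to it.
  So it is itself a successor.\<close>

lemma I_minus_two:
  assumes "Suc i \<in> I"
  shows "\<exists>j\<in>I. i = Suc j"
proof -
  have len: "Suc (Suc i) < length P" using I_Suc assms by simp
  have "E (P ! Suc i) (P ! i)" using edge E_commute len by (metis Suc_lessD)
  moreover have "\<not> E w (P ! i)" using move_insert[OF w_off] I_E assms len by (metis Suc_lessD)
  moreover have "\<not> E (S (Suc i)) (P ! i)"
    using exists_other_S[OF assms] move_relocate[OF w_off I_E I_E _ I_Suc I_Suc, of "Suc i"]
      assms E_commute by fastforce
  moreover have "P ! i \<noteq> w" using w_off len by auto
  ultimately obtain j where "j \<in> I" "P ! i = S j" using N_subset[OF assms] by auto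
  then show ?thesis using nth_eq[of i "Suc j"] len I_Suc by auto
qed

text \<open>Here \<open>N_subset\<close> is applied to \<open>x\<close> and its neighbour
  \<open>y\<close>: adjacency of \<open>y\<close> to \<open>S 0\<close> would make
  \<open>S 0\<close> a common neighbour of \<open>x\<close> and \<open>y\<close>, so
  \<open>y\<close> can only be a successor.\<close>

lemma last_S_if_0:
  assumes "0 \<in> I"
  shows "\<exists>j\<in>I. length P = Suc (Suc j)"
proof -
  have x: "P ! 0 = x" using P_props by (simp add: hd_conv_nth)
  have "y \<noteq> w" using P_props w_off by auto
  moreover have "\<not> E (S 0) y"
    using xy(2) edge[OF I_Suc[OF assms]] E_commute unfolding x by fastforce
  ultimately obtain j where j: "j \<in> I" "y = S j"
    using N_subset[OF assms] w_y xy(1) unfolding x by auto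
  have "y = P ! (length P - 1)" using P_props by (simp add: last_conv_nth)
  moreover have "length P - 1 < length P" using P_props(3) by simp
  ultimately have "Suc j = length P - 1"
    using j I_Suc[of j] nth_eq[of "Suc j" "length P - 1"] by auto
  then have "length P = Suc (Suc j)" using I_Suc[OF j(1)] by simp
  then show ?thesis using j(1) by blast
qed

lemma I_downward: "i \<in> I \<Longrightarrow> even i \<and> (\<forall>j\<le>i. even j \<longrightarrow> j \<in> I)"
proof (induction i rule: less_induct)
  case (less i)
  show ?case
  proof (cases i)
    case (Suc k)
    then obtain l where l: "l \<in> I" "i = Suc (Suc l)" using I_minus_two less.prems by auto
    then have "even l \<and> (\<forall>j\<le>l. even j \<longrightarrow> j \<in> I)" using less.IH[of l] by simp
    then show ?thesis using l less.prems by (auto simp: le_Suc_eq)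
  qed (use less.prems in auto)
qed

lemma even_length: "even (length P)"
  and I_eq: "I = {i. i < length P \<and> even i}"
  and four_le_length: "4 \<le> length P"
proof -
  obtain i where i: "i \<in> I" using w_attached unfolding I_def by (fastforce simp: in_set_conv_nth)
  then have "0 \<in> I" using I_downward by auto
  then obtain l where l: "l \<in> I" "length P = Suc (Suc l)" using last_S_if_0 by auto
  then show "even (length P)" using I_downward by auto
  show I: "I = {i. i < length P \<and> even i}"
  proof (intro equalityI subsetI)
    fix k assume "k \<in> {i. i < length P \<and> even i}"
    moreover from this have "k \<le> l"
      using l(2) I_downward[OF l(1)] by (auto simp: less_Suc_eq_le le_Suc_eq)
    ultimately show "k \<in> I" using I_downward[OF l(1)] by simp
  qed (use I_downward in \<open>auto simp: I_def\<close>)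
  show "4 \<le> length P"
  proof (rule ccontr)
    assume "\<not> ?thesis"
    \<comment> \<open>A path on two vertices would leave \<open>S 0\<close> as the only successor,
      against \<open>exists_other_S\<close>.\<close>
    then have "length P \<le> 2" using \<open>even (length P)\<close> by (auto elim!: evenE)
    then have "I \<subseteq> {0}" unfolding I by (auto simp: less_Suc_eq_le le_Suc_eq numeral_2_eq_2)
    then show False using exists_other_S[OF \<open>0 \<in> I\<close>] by auto
  qed
qed


section \<open>Other vertices off the path, and the neighbourhoods of the successors\<close>

lemma zero_two_I: "0 \<in> I" "2 \<in> I"
  using four_le_length P_props(3) by (simp_all add: I_eq)

text \<open>A vertex off \<open>P\<close> adjacent to \<open>y\<close> would, by the mirrored argument, be adjacent to exactly the odd
  positions of \<open>P\<close>, so that it and \<open>w\<close> could be inserted simultaneously.\<close>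

lemma attached_not_y:
  assumes "z \<notin> set P" "N z \<inter> set P \<noteq> {}"
  shows "\<not> E z y"
proof
  assume z: "E z y"
  then have "\<not> E z x" using xy(2) sym by (meson disjoint_iff in_N)
  then interpret R: attached_vertex E y x "rev P" z
    using unextendable_rev[OF unext] sym[OF xy(1)] xy(2) assms
    by unfold_locales (simp_all add: Int_commute)
  have rev: "E z (P ! i)" if "odd i" "i < length P" for i
  proof -
    have "length P - Suc i \<in> R.I"
      using that R.even_length unfolding R.I_eq by simp
    then have "E z (rev P ! (length P - Suc i))" by (rule R.I_E)
    then show ?thesis using that by (simp add: rev_nth)
  qed
  have "w \<noteq> z" using w_y z by auto
  moreover have "E z (P ! 1)" "E z (P ! 3)" using rev four_le_length by simp_all
  ultimately show False
    using move_two_types[OF four_le_length w_off assms(1)] I_E zero_two_I by blast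
qed

lemma attached_vertexI: "z \<notin> set P \<Longrightarrow> N z \<inter> set P \<noteq> {} \<Longrightarrow> attached_vertex E x y P z"
  by unfold_locales (simp_all add: attached_not_y)

text \<open>Since \<open>z\<close> avoids \<open>y\<close> as well, everything shown for
  \<open>w\<close> holds for \<open>z\<close>, in particular \<open>I_eq\<close>.\<close>

lemma attached_E_iff:
  assumes "z \<notin> set P" "N z \<inter> set P \<noteq> {}" "i < length P"
  shows "E z (P ! i) \<longleftrightarrow> even i"
proof -
  interpret Z: attached_vertex E x y P z
    by (rule attached_vertexI) (fact assms)+
  have "i \<in> Z.I \<longleftrightarrow> even i" using Z.I_eq assms(3) by simp
  then show ?thesis using assms(3) by (simp add: Z.I_def)
qed

lemma set_P_eq: "set P = (!) P ` I \<union> S ` I"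
proof
  show "set P \<subseteq> (!) P ` I \<union> S ` I"
  proof
    fix v assume "v \<in> set P"
    then obtain k where k: "k < length P" "v = P ! k" by (auto simp: in_set_conv_nth)
    show "v \<in> (!) P ` I \<union> S ` I"
    proof (cases "even k")
      case False
      then obtain j where "k = Suc j" "even j" by (cases k) auto
      then show ?thesis using k by (auto simp: I_eq)
    qed (use k in \<open>auto simp: I_eq\<close>)
  qed
qed (use I_Suc in \<open>auto simp: I_def\<close>)

text \<open>A neighbour off \<open>P\<close> would be attached at the odd position
  \<open>Suc i\<close>; on \<open>P\<close>, the successors are independent.\<close>

lemma N_S_subset:
  assumes "i \<in> I"
  shows "N (S i) \<subseteq> (!) P ` I"
proof
  fix v assume v: "v \<in> N (S i)"
  have "v \<in> set P"
  proof (rule ccontr)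
    assume "v \<notin> set P"
    moreover have "S i \<in> N v \<inter> set P" using v I_Suc[OF assms] E_commute by auto
    ultimately have "even (Suc i)"
      using attached_E_iff[of v "Suc i"] I_Suc[OF assms] by fastforce
    then show False using assms by (simp add: I_eq)
  qed
  then show "v \<in> (!) P ` I" using v S_indep[OF assms] unfolding set_P_eq by auto
qed

lemma N_S_subset_N_w: "i \<in> I \<Longrightarrow> N (S i) \<subseteq> N w"
  using N_S_subset I_E by fastforce

text \<open>In \<open>local_ore\<close> for \<open>S i\<close>, \<open>S k\<close> and the middle
  vertex \<open>P ! k\<close>, the private neighbours of \<open>P ! k\<close> include all of
  \<open>Z\<close> and the successors adjacent to it, of which there are as many as neighbours of
  \<open>S k\<close>. Taking \<open>Z\<close> as \<open>{w}\<close> compares neighbourhoods; a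
  second element of \<open>Z\<close> is contradictory.\<close>

lemma local_ore_S_S:
  assumes "i \<in> I" "k \<in> I" "i \<noteq> k" "E (P ! k) (S i)"
    and Z: "finite Z" "\<And>z. z \<in> Z \<Longrightarrow> z \<notin> set P \<and> N z \<inter> set P \<noteq> {}"
  shows "card (N (S k)) + card Z \<le> card (N (S i) \<inter> N (S k)) + 1"
proof -
  let ?T = "S ` {j \<in> I. E (P ! k) (S j)}"
  have S: "S i \<noteq> S k" using inj_S assms(1-3) by (auto simp: inj_on_def)
  have Zk: "E z (P ! k)" "\<not> E z (S i)" "\<not> E z (S k)" if "z \<in> Z" for z
    using Z(2)[OF that] attached_E_iff assms(1,2) I_Suc by (auto simp: I_eq)
  have "?T \<inter> Z = {}" using Z(2) I_Suc by fastforce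
  then have T: "card (?T \<union> Z) = card ?T + card Z"
    using Z(1) finite_I by (simp add: card_Un_disjoint)
  have "card ?T = card (N w \<inter> N (S k))"
    using card_common_S_eq[OF assms(2)] by (simp add: card_image inj_on_subset[OF inj_S])
  also have "N w \<inter> N (S k) = N (S k)" using N_S_subset_N_w[OF assms(2)] by auto
  finally have "card (N (S k)) + card Z = card (?T \<union> Z)" using T by simp
  also have "card (?T \<union> Z) \<le> card (N (P ! k) - (N (S i) \<union> N (S k)))"
    by (intro card_mono) (use finite_N Zk S_indep assms(1,2) E_commute in auto)
  also have "\<dots> \<le> card (N (S i) \<inter> N (S k)) + 1"
    using local_ore[OF S S_indep[OF assms(1,2)] assms(4)] edge I_Suc[OF assms(2)] by blast
  finally show ?thesis by simp
qed

lemma N_S_mono_step: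
  assumes "i \<in> I" "k \<in> I" "i \<noteq> k" "E (P ! k) (S i)"
  shows "N (S k) \<subseteq> N (S i)"
proof -
  have "card (N (S k)) \<le> card (N (S i) \<inter> N (S k))"
    using local_ore_S_S[OF assms, of "{w}"] w_off w_attached by auto
  then have "N (S i) \<inter> N (S k) = N (S k)" by (intro card_seteq) (use finite_N in auto)
  then show ?thesis by blast
qed

lemma off_unique:
  assumes "z \<notin> set P" "N z \<inter> set P \<noteq> {}"
  shows "z = w"
proof (rule ccontr)
  assume "z \<noteq> w"
  have "E (P ! 2) (S 0)" using edge[of 1] E_commute four_le_length by (simp add: numeral_2_eq_2)
  then have "card (N (S 2)) + card {w, z} \<le> card (N (S 0) \<inter> N (S 2)) + 1"
    using assms w_off w_attached zero_two_I by (intro local_ore_S_S) auto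
  moreover have "card (N (S 0) \<inter> N (S 2)) \<le> card (N (S 2))"
    by (intro card_mono) (use finite_N in auto)
  ultimately show False using \<open>z \<noteq> w\<close> by simp
qed

lemma N_S_antimono: "i \<in> I \<Longrightarrow> j \<in> I \<Longrightarrow> j \<le> i \<Longrightarrow> N (S i) \<subseteq> N (S j)"
proof (induction i rule: less_induct)
  case (less i)
  show ?case
  proof (cases "i = j")
    case False
    define k where "k = i - 2"
    have "even i" "even j" "i < length P" using less.prems by (auto simp: I_eq)
    then have k: "i = Suc (Suc k)" "j \<le> k" "k \<in> I"
      using False less.prems(3) unfolding I_eq k_def by (auto elim!: evenE)
    have "E (P ! i) (S k)"
      using edge[of "Suc k"] E_commute k(1) \<open>i < length P\<close> by simp
    then have "N (S i) \<subseteq> N (S k)"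
      using k less.prems(1) by (intro N_S_mono_step) auto
    also have "\<dots> \<subseteq> N (S j)" using less.IH[of k] k less.prems(2) by simp
    finally show ?thesis .
  qed simp
qed

text \<open>The neighbourhoods of the successors decrease along \<open>P\<close>; the edge \<open>xy\<close> closes the chain, so they
  are all equal.\<close>

lemma complete:
  assumes "i \<in> I" "j \<in> I"
  shows "E (P ! i) (S j)"
proof -
  define l where "l = length P - 2"
  have l: "l \<in> I" "\<And>k. k \<in> I \<Longrightarrow> k \<le> l" "l \<noteq> 0" "Suc l = length P - 1"
    using four_le_length even_length by (auto simp: l_def I_eq elim!: evenE)
  have "E (P ! 0) (S l)"
    using xy(1) P_props l(4) by (simp add: hd_conv_nth last_conv_nth)
  then have "N (S 0) \<subseteq> N (S l)" using l zero_two_I by (intro N_S_mono_step) auto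
  moreover have "N (S i) \<subseteq> N (S 0)" "N (S l) \<subseteq> N (S j)"
    using N_S_antimono zero_two_I l(1,2) assms by simp_all
  moreover have "P ! i \<in> N (S i)" using sym[OF edge[OF I_Suc[OF assms(1)]]] by simp
  ultimately have "P ! i \<in> N (S j)" by blast
  then show ?thesis using E_commute by simp
qed

section \<open>The complete bipartite structure\<close>

lemma N_subset_P: "u \<in> set P \<Longrightarrow> N u \<subseteq> insert w (set P)"
  using off_unique E_commute by fastforce

lemma N_w: "N w = (!) P ` I"
proof
  show "N w \<subseteq> (!) P ` I"
  proof
    fix v assume v: "v \<in> N w"
    have "v \<in> set P"
    proof (rule ccontr)
      assume off: "v \<notin> set P"
      have "v \<noteq> w" using v irrefl by auto
      then have none: "N v \<inter> set P = {}" using off_unique off by blast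
      have x: "x \<in> set P" using P_props by auto
      have "E w x" using I_E[OF zero_two_I(1)] P_props by (simp add: hd_conv_nth)
      \<comment> \<open>A neighbour \<open>v\<close> of \<open>w\<close> that avoids
        \<open>P\<close> is at distance two from \<open>x\<close>, but they share only
        \<open>w\<close>.\<close>
      then have "2 \<le> card (N v \<inter> N x)" using v off x none by (intro two_common) auto
      also have "\<dots> \<le> card {w}" using N_subset_P[OF x] none by (intro card_mono) auto
      finally show False by simp
    qed
    then show "v \<in> (!) P ` I" using v by (auto simp: in_set_conv_nth I_def)
  qed
qed (auto simp: I_def)

text \<open>Take \<open>W\<close> as the even positions and \<open>U\<close> as \<open>w\<close>
  with the odd positions. The final closure property later lets connectedness identify
  \<open>W \<union> U\<close> with the whole vertex set.\<close>

lemma attached_complete_bipartite_structure: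
  obtains p W U where "2 \<le> p" "length P = 2 * p" "card W = p" "card U = p + 1" "W \<inter> U = {}"
    "W \<union> U = insert w (set P)" "\<And>u v. u \<in> W \<Longrightarrow> v \<in> U \<Longrightarrow> E u v" "\<And>u. u \<in> U \<Longrightarrow> N u \<subseteq> W"
    "\<And>u. u \<in> W \<union> U \<Longrightarrow> N u \<subseteq> W \<union> U"
proof
  let ?W = "(!) P ` I" and ?U = "insert w (S ` I)"
  have disj: "?W \<inter> S ` I = {}" using nth_eq I_Suc by (force simp: I_eq)
  have w: "w \<notin> ?W" "w \<notin> S ` I" using w_off set_P_eq by auto
  have "card {0, 2::nat} \<le> card I" using finite_I zero_two_I by (intro card_mono) auto
  then show "2 \<le> card I" by simp
  show W: "card ?W = card I" by (simp add: card_image inj_P)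
  have U: "card (S ` I) = card I" by (simp add: card_image inj_S)
  then show "card ?U = card I + 1" using w finite_I by simp
  have "length P = card (set P)" using P_props(2) by (simp add: distinct_card)
  also have "\<dots> = 2 * card I"
    unfolding set_P_eq using W U disj finite_I by (simp add: card_Un_disjoint)
  finally show "length P = 2 * card I" .
  show "?W \<inter> ?U = {}" using disj w by auto
  show WU: "?W \<union> ?U = insert w (set P)" using set_P_eq by auto
  show "E u v" if "u \<in> ?W" "v \<in> ?U" for u v using that complete I_E E_commute by auto
  show N_U: "N u \<subseteq> ?W" if "u \<in> ?U" for u using that N_S_subset N_w by auto
  show "N u \<subseteq> ?W \<union> ?U" if "u \<in> ?W \<union> ?U" for u
    unfolding WU using that[unfolded WU] N_subset_P N_w by (auto simp: I_def)
qed

end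

context unextendable_path
begin

lemma complete_bipartite_structure:
  assumes "w \<notin> set P" "N w \<inter> set P \<noteq> {}"
  obtains p W U where "2 \<le> p" "length P = 2 * p" "card W = p" "card U = p + 1" "W \<inter> U = {}"
    "W \<union> U = insert w (set P)" "\<And>u v. u \<in> W \<Longrightarrow> v \<in> U \<Longrightarrow> E u v" "\<And>u. u \<in> U \<Longrightarrow> N u \<subseteq> W"
    "\<And>u. u \<in> W \<union> U \<Longrightarrow> N u \<subseteq> W \<union> U"
proof (cases "E w y")
  case False
  then interpret attached_vertex E x y P w
    using assms by unfold_locales
  show ?thesis using attached_complete_bipartite_structure that by blast
next
  case True
  \<comment> \<open>Now \<open>w\<close> avoids the other end, so the reversed path satisfies the
    assumptions of \<open>attached_vertex\<close>.\<close>
  then have "\<not> E w x" using xy(2) sym by (meson disjoint_iff in_N)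
  then interpret attached_vertex E y x "rev P" w
    using unextendable_rev[OF unext] sym[OF xy(1)] xy(2) assms
    by unfold_locales (simp_all add: Int_commute)
  show ?thesis using attached_complete_bipartite_structure that unfolding length_rev set_rev by blast
qed

end

section \<open>Transfer to digraphs\<close>

lemma set_vwalk_arcs_subset_iff: "set (vwalk_arcs p) \<subseteq> R \<longleftrightarrow> successively (\<lambda>u v. (u, v) \<in> R) p"
  by (induction p rule: vwalk_arcs.induct) auto

lemma successively_closed:
  "successively E p \<Longrightarrow> p \<noteq> [] \<Longrightarrow> hd p \<in> V \<Longrightarrow> (\<And>u v. u \<in> V \<Longrightarrow> E u v \<Longrightarrow> v \<in> V) \<Longrightarrow> set p \<subseteq> V"
proof (induction p)
  case (Cons a p)
  then show ?case by (cases p) (auto simp: successively_Cons)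
qed simp

lemma (in pair_wf_digraph) neighborhood_eq_nbhd:
  "neighborhood G u = nbhd (\<lambda>u v. (u, v) \<in> parcs G) u"
  by (auto simp: neighborhood_def nbhd_def dest: in_arcsD2)

text \<open>The walk through \<open>w\<close> gives the upper bound; a walk with at most one arc
  would force \<open>u = v\<close> or an arc from \<open>u\<close> to \<open>v\<close>.\<close>

lemma (in pair_bidirected_digraph) distance_eq_two:
  assumes "u \<noteq> v" "(u, v) \<notin> parcs G" "(u, w) \<in> parcs G" "(w, v) \<in> parcs G"
  shows "distance G u v = 2"
proof (rule antisym)
  have "awalk u [(u, w), (w, v)] v"
    using assms wellformed' by (auto simp: awalk_simps)
  then have "distance G u v \<le> ereal (awalk_cost (\<lambda>_. 1) [(u, w), (w, v)])"
    unfolding distance_def by (rule min_cost_le_walk_cost)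
  then show "distance G u v \<le> 2" by simp
  have "2 \<le> ereal (awalk_cost (\<lambda>_. 1) p)" if "awalk u p v" for p
  proof -
    have "awalk_cost (\<lambda>_. 1) p = length p"
      by (simp add: awalk_cost_def sum_list_triv)
    moreover have "2 \<le> length p"
    proof (rule ccontr)
      assume "\<not> ?thesis"
      then consider "p = []" | e where "p = [e]"
        by (cases p; cases "tl p") auto
      then show False using that assms(1,2) by cases (auto simp: awalk_simps)
    qed
    ultimately show ?thesis by simp
  qed
  then show "2 \<le> distance G u v"
    unfolding distance_def \<mu>_def by (intro INF_greatest) auto
qed

lemma class_KI:
  fixes G :: "'a pair_pre_digraph"
  assumes G: "pair_bidirected_digraph G"
    and p: "2 \<le> p" "card W = p" "card U = p + 1" "W \<inter> U = {}" "pverts G = W \<union> U"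
    and complete: "\<And>u v. u \<in> W \<Longrightarrow> v \<in> U \<Longrightarrow> (u, v) \<in> parcs G"
    and indep: "\<And>u. u \<in> U \<Longrightarrow> neighborhood G u \<subseteq> W"
  shows "class_K G"
proof -
  interpret pair_bidirected_digraph G by (rule G)
  have fin: "finite W" "finite U" using p(1-3) by (auto intro: card_ge_0_finite)
  define B where "B = \<lparr>pverts = W \<union> U, parcs = W \<times> U \<union> U \<times> W\<rparr>"
  define C where "C = \<lparr>pverts = W, parcs = {(u, v). (u, v) \<in> W \<times> W \<and> u \<noteq> v}\<rparr>"
  define D :: "'a pair_pre_digraph" where "D = \<lparr>pverts = U, parcs = {}\<rparr>"
  have "complete_bipartite_digraph p (p + 1) (with_proj B)"
    unfolding complete_bipartite_digraph_pair_def using p fin by (auto simp: B_def)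
  moreover have "complete_digraph p (with_proj C)"
    unfolding complete_digraph_pair_def using p fin by (auto simp: C_def)
  moreover have "edgeless_graph (p + 1) D"
    using p fin by (simp add: edgeless_graph_def D_def)
  moreover have "pverts C \<inter> pverts D = {}"
    using p by (simp add: C_def D_def)
  moreover have "subgraph (with_proj B) (with_proj G)"
  proof -
    have "pair_wf_digraph B" by unfold_locales (auto simp: B_def)
    moreover have "parcs B \<subseteq> parcs G"
      using complete arcs_symmetric by (auto simp: B_def)
    ultimately show ?thesis
      using p(5) pair_wf_digraph_axioms
      by (auto simp: subgraph_def compatible_def wf_digraph_wp_iff B_def)
  qed
  moreover have "subgraph (with_proj G) (with_proj (graph_join C D))"
  proof -
    have "pair_wf_digraph (graph_join C D)"
      by unfold_locales (auto simp: graph_join_def C_def D_def)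
    moreover have "parcs G \<subseteq> parcs (graph_join C D)"
    proof (rule subrelI)
      fix u v assume uv: "(u, v) \<in> parcs G"
      have "u \<in> W \<union> U" "v \<in> W \<union> U"
        using uv wellformed' p(5) by auto
      moreover have "u \<noteq> v" using pair_no_loops[OF uv] by simp
      moreover have "\<not> (u \<in> U \<and> v \<in> U)"
        using indep uv p(4,5) wellformed'(2) by (fastforce simp: neighborhood_def)
      ultimately show "(u, v) \<in> parcs (graph_join C D)"
        by (auto simp: graph_join_def C_def D_def)
    qed
    ultimately show ?thesis
      using p(5) pair_wf_digraph_axioms
      by (auto simp: subgraph_def compatible_def wf_digraph_wp_iff graph_join_def C_def D_def)
  qed
  ultimately show ?thesis unfolding class_K_def using p(1) by blast
qed

lemma (in pair_bidirected_digraph) local_ore_graph_parcs: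
  assumes "locally_finite G" "L1_graph G"
    and two: "\<forall>u \<in> pverts G. \<forall>v \<in> pverts G. distance G u v = 2 \<longrightarrow>
           card (neighborhood G u \<inter> neighborhood G v) \<ge> 2"
  shows "local_ore_graph (\<lambda>u v. (u, v) \<in> parcs G)" (is "local_ore_graph ?E")
proof
  show sym: "?E v u" if "?E u v" for u v
    using that by (rule arcs_symmetric)
  show "\<not> ?E u u" for u
    using pair_no_loops by fastforce
  show fin: "finite (nbhd ?E u)" for u
  proof (cases "u \<in> pverts G")
    case True
    then show ?thesis
      using assms(1) by (simp add: locally_finite_def neighborhood_eq_nbhd)
  next
    case False
    \<comment> \<open>The locale ranges over the whole type, and elements outside the graph have no
      neighbours.\<close>
    then have "nbhd ?E u = {}" using wellformed'(1) by (auto simp: nbhd_def)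
    then show ?thesis by simp
  qed
  fix u v w assume uv: "u \<noteq> v" "(u, v) \<notin> parcs G" "(w, u) \<in> parcs G" "(w, v) \<in> parcs G"
  have d: "distance G u v = 2"
    using distance_eq_two[OF uv(1,2) sym[OF uv(3)] uv(4)] .
  have V: "u \<in> pverts G" "v \<in> pverts G"
    using uv wellformed' by auto
  show "2 \<le> card (nbhd ?E u \<inter> nbhd ?E v)"
    using two d V by (simp add: neighborhood_eq_nbhd)
  have "w \<in> nbhd ?E u \<inter> nbhd ?E v"
    using uv sym by (simp add: nbhd_def)
  then have "card (nbhd ?E u \<union> nbhd ?E v \<union> nbhd ?E w) \<le> card (nbhd ?E u) + card (nbhd ?E v) + 1"
    using assms(2) d V unfolding L1_graph_def degree_def neighborhood_eq_nbhd by fastforce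
  moreover have "card (nbhd ?E u \<union> nbhd ?E v \<union> nbhd ?E w)
      = card (nbhd ?E u \<union> nbhd ?E v) + card (nbhd ?E w - (nbhd ?E u \<union> nbhd ?E v))"
    using card_Un_disjoint[of "nbhd ?E u \<union> nbhd ?E v" "nbhd ?E w - (nbhd ?E u \<union> nbhd ?E v)"] fin
    by simp
  moreover have "card (nbhd ?E u) + card (nbhd ?E v)
      = card (nbhd ?E u \<union> nbhd ?E v) + card (nbhd ?E u \<inter> nbhd ?E v)"
    using card_Un_Int fin by blast
  ultimately show "card (nbhd ?E w - (nbhd ?E u \<union> nbhd ?E v)) \<le> card (nbhd ?E u \<inter> nbhd ?E v) + 1"
    by linarith
qed

lemma (in pair_bidirected_digraph) connected_closed_eq:
  assumes "Digraph_Component.connected (with_proj G)"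
    and "X \<subseteq> pverts G" "X \<noteq> {}" "\<And>u v. u \<in> X \<Longrightarrow> (u, v) \<in> parcs G \<Longrightarrow> v \<in> X"
  shows "X = pverts G"
proof (rule equalityI[OF assms(2)], rule subsetI)
  fix v assume v: "v \<in> pverts G"
  obtain u where u: "u \<in> X" using assms(3) by blast
  have "strongly_connected (with_proj G)"
    using symmetric_connected_imp_strongly_connected pair_sym_arcs assms(1) by blast
  then have "u \<rightarrow>\<^sup>*\<^bsub>with_proj G\<^esub> v"
    using u v assms(2) by (auto simp: strongly_connected_def)
  then show "v \<in> X"
    by (induction rule: reachable_induct) (use u assms(4) in auto)
qed

theorem theorem5:
  fixes G :: "'a pair_pre_digraph" and x y :: 'a
  assumes "pair_bidirected_digraph G"
    and "Digraph_Component.connected (with_proj G)"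
    and "locally_finite G"
    and "infinite (pverts G) \<or> card (pverts G) \<ge> 3"
    and "L1_graph G"
    and "\<forall>u \<in> pverts G. \<forall>v \<in> pverts G. distance G u v = 2 \<longrightarrow>
           card (neighborhood G u \<inter> neighborhood G v) \<ge> 2"
    and "x \<in> pverts G" and "y \<in> pverts G"
    and "(x, y) \<in> parcs G"
    and "neighborhood G x \<inter> neighborhood G y = {}"
  shows "\<forall>(n::nat) P. path_between G x P y \<and> length P = n \<and> set P \<noteq> pverts G \<longrightarrow>
           \<not> (finite (pverts G) \<and> n = card (pverts G) - 1 \<and> class_K G) \<longrightarrow>
           (\<exists>(l::nat) Q. 1 \<le> l \<and> l \<le> 2 \<and> path_between G x Q y \<and> length Q = n + l \<and>
              set P \<subset> set Q)"
proof (intro allI impI, elim conjE)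
  fix n P
  assume P: "path_between G x P y" and n: "length P = n" and off: "set P \<noteq> pverts G"
    and not_K: "\<not> (finite (pverts G) \<and> n = card (pverts G) - 1 \<and> class_K G)"
  interpret pair_bidirected_digraph G by (rule assms(1))
  define E where "E = (\<lambda>u v. (u, v) \<in> parcs G)"
  interpret local_ore_graph E
    unfolding E_def using assms(3,5,6) by (rule local_ore_graph_parcs)
  have nbhd: "neighborhood G u = nbhd E u" for u
    unfolding E_def by (rule neighborhood_eq_nbhd)
  have path_iff: "path_between G x Q y \<longleftrightarrow> path x Q y" for Q
  proof -
    have "set Q \<subseteq> pverts G" if "successively E Q" "Q \<noteq> []" "hd Q = x"
      using that assms(7) wellformed'(2) by (intro successively_closed[of E]) (auto simp: E_def)
    then show ?thesis
      unfolding path_between_def path_def vpath_def vwalk_def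
      by (auto simp: set_vwalk_arcs_subset_iff E_def)
  qed
  show "\<exists>l Q. 1 \<le> l \<and> l \<le> 2 \<and> path_between G x Q y \<and> length Q = n + l \<and> set P \<subset> set Q"
  proof (rule ccontr)
    assume no_ext: "\<not> ?thesis"
    have "unextendable x P y"
      unfolding unextendable_def
    proof (intro conjI allI impI)
      fix Q assume "path x Q y" "set P \<subset> set Q"
      then show "length Q \<noteq> length P + 1" "length Q \<noteq> length P + 2"
        using no_ext n path_iff by fastforce+
    qed (use P path_iff in simp)
    then interpret unextendable_path E x y P
      using assms(9,10) by unfold_locales (simp_all add: E_def neighborhood_eq_nbhd)
    have P_V: "set P \<subseteq> pverts G"
      using P by (auto simp: path_between_def vpath_def vwalk_def)
    \<comment> \<open>By connectedness some edge leaves the path.\<close>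
    then obtain u w where uw: "u \<in> set P" "E u w" "w \<notin> set P"
      using connected_closed_eq[OF assms(2), of "set P"] off P_props(3) unfolding E_def by auto
    then have "N w \<inter> set P \<noteq> {}" using sym[of u w] by auto
    with uw(3) obtain p W U where K: "2 \<le> p" "length P = 2 * p" "card W = p" "card U = p + 1"
        "W \<inter> U = {}" "W \<union> U = insert w (set P)" "\<And>u v. u \<in> W \<Longrightarrow> v \<in> U \<Longrightarrow> E u v"
        "\<And>u. u \<in> U \<Longrightarrow> N u \<subseteq> W" "\<And>u. u \<in> W \<union> U \<Longrightarrow> N u \<subseteq> W \<union> U"
      using complete_bipartite_structure by metis
    have "w \<in> pverts G" using uw(2) wellformed'(2) by (auto simp: E_def)
    then have V: "W \<union> U = pverts G"
      using K(6,9) P_V by (intro connected_closed_eq[OF assms(2)]) (auto simp: E_def nbhd_def)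
    then have "class_K G"
      using K by (intro class_KI[OF assms(1), of p W U]) (simp_all add: nbhd E_def)
    \<comment> \<open>With \<open>w\<close> the only vertex off \<open>P\<close>, the excluded
      exceptional case is reached.\<close>
    moreover have "card (pverts G) = length P + 1"
      using V K(6) uw(3) P_props(2) by (metis List.finite_set Suc_eq_plus1 card_insert_disjoint distinct_card)
    moreover have "finite (pverts G)" using V K(6) by (metis List.finite_set finite_insert)
    ultimately show False using not_K n by simp
  qed
qed


end
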